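(* Let $E \subset \mathbb{R}^n$, $n \ge 2$, be an open (or closed) $n$-dimensional Euclidean unit ball. Then its Reeb width $b(E)$ satisfies: (i) if $n = 2$: $b(E) \ge \sqrt{3}$; (ii) if $n \ge 3$: $b(E) = 2$. Moreover, for any continuous function $f : E \to \mathbb{R}$ there exist $x, y \in \partial E$ with $\|x - y\| \ge \sqrt{3}$ (if $n = 2$) or $\|x - y\| = 2$ (if $n \ge 3$) such that for any neighborhoods $U$ of $x$ and $V$ of $y$ there exists a contour $C$ of $f$ with $C \cap U \neq \emptyset$ and $C \cap V \neq \emptyset$.
   Context: A contour of $f : E \to \mathbb{R}$ is a connected component of a level set $f^{-1}(y)$ for some $y \in \mathbb{R}$. The Reeb width of a metric space $X$ is $$b(X) = \inf_{\substack{\text{continuous} \\ f : X \to \mathbb{R}}} \ \sup_{\text{contours } C \text{ of } f} \operatorname{diam}(C).$$ $\partial E$ is the unit sphere bounding $E$ in $\mathbb{R}^n$; neighborhoods of points of $\partial E$ are taken in $\mathbb{R}^n$; $E$ has the Euclidean metric. *)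

theory Defs
  imports "HOL-Analysis.Analysis"
begin

definition contours :: "'a::topological_space set \<Rightarrow> ('a \<Rightarrow> real) \<Rightarrow> 'a set set" where
  "contours X f = (\<Union>y. components {x \<in> X. f x = y})"

text \<open>The diameter takes values in \<open>[0, \<infinity>]\<close>; the library's real-valued \<^const>\<open>diameter\<close> has no
  meaningful value on unbounded sets, which may occur as contours in a general metric space.\<close>

definition ediameter :: "'a::metric_space set \<Rightarrow> ennreal" where
  "ediameter S = (SUP x\<in>S. SUP y\<in>S. ennreal (dist x y))"

text \<open>A metric space is given as a subset \<open>X\<close> of a metric type. Functions on \<open>X\<close> are represented by
  total functions; neither \<open>continuous_on X f\<close> nor \<open>contours X f\<close> depends on values outside \<open>X\<close>.\<close>

definition reeb_width :: "'a::metric_space set \<Rightarrow> ennreal" where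
  "reeb_width X =
    (INF f \<in> {f :: 'a \<Rightarrow> real. continuous_on X f}. SUP C \<in> contours X f. ediameter C)"

end

theory Submission
  imports Defs
begin

text \<open>Collapsing the level components of \<open>f\<close> on a unicoherent, locally connected continuum \<open>X\<close> yields
  a dendrite-like tree, and a tree has the fixed point property: one cannot choose at every vertex a
  direction (a complementary component of the level component) in a locally constant way. If
  \<open>n \<ge> 3\<close>, take \<open>X\<close> to be the sphere, which is unicoherent; were no level component to contain
  antipodal points, the component of the complement containing the antipodes would be such a choice.
  If \<open>n = 2\<close>, take \<open>X\<close> to be the disc; if every level component met the circle only in points at mutual
  distance less than \<open>sqrt 3\<close>, it would miss a closed arc of length \<open>4 \<pi> / 3\<close>, and since any two such arcs meet,
  the component containing this arc would be such a choice. The statements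
  for the possibly open ball follow by shrinking the radius slightly and passing to a limit.\<close>

subsection \<open>Separation in unicoherent spaces\<close>

lemma closure_connected_component_Int:
  "closure (connected_component_set W p) \<inter> W \<subseteq> connected_component_set W p"
proof -
  obtain T where "closed T" "connected_component_set W p = W \<inter> T"
    using closedin_connected_component[of W p] by (auto simp: closedin_closed)
  then show ?thesis
    by (metis Int_lower2 Int_mono closure_minimal inf_commute order_refl)
qed

lemma openin_connected_component_set:
  assumes "locally connected X" "openin (top_of_set X) W"
  shows "openin (top_of_set X) (connected_component_set W x)"
  using assms openin_connected_component_locally_connected[of W x] locally_open_subset openin_trans
  by blast

lemma openin_Int_closure_empty:
  assumes "openin (top_of_set X) W" "W \<inter> T = {}" "T \<subseteq> X"
  shows "W \<inter> closure T = {}"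
proof -
  obtain G where "open G" "W = X \<inter> G" using assms(1) by (auto simp: openin_open)
  moreover from this have "G \<inter> T = {}" using assms by auto
  ultimately show ?thesis by (metis Int_assoc inf_bot_right open_Int_closure_eq_empty)
qed

text \<open>Take the component \<open>U\<close> of \<open>p\<close> in \<open>X - L\<close>, then
  the component \<open>V\<close> of \<open>q\<close> in \<open>X - closure U\<close>. The boundary
  of \<open>V\<close> in \<open>X\<close> separates \<open>p\<close> from \<open>q\<close>, lies in
  \<open>L\<close>, and is the intersection of two closed connected sets covering \<open>X\<close>,
  hence connected by unicoherence.\<close>

lemma unicoherent_separation:
  fixes X :: "'a::real_normed_vector set"
  assumes X: "closed X" "connected X" "locally connected X" "unicoherent X"
    and L: "closed L" "L \<subseteq> X" and p: "p \<in> X - L" and q: "q \<in> X - L"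
    and sep: "\<not> connected_component (X - L) p q"
  obtains K where "K \<subseteq> L" "connected K" "\<not> connected_component (X - K) p q"
proof -
  have XL: "openin (top_of_set X) (X - L)"
    using L by (simp add: closed_subset openin_diff)
  define U where "U = connected_component_set (X - L) p"
  have U: "openin (top_of_set X) U" "connected U" "p \<in> U" "U \<subseteq> X - L"
    unfolding U_def using openin_connected_component_set[OF X(3) XL] p
      connected_component_subset[of "X - L"] by auto
  have clU: "closure U \<subseteq> X"
    using U X(1) by (meson Diff_subset closure_minimal order_trans)
  define Q where "Q = connected_component_set (X - L) q"
  have Q: "openin (top_of_set X) Q" "q \<in> Q" 
    unfolding Q_def using openin_connected_component_set[OF X(3) XL] q by auto
  have QU: "Q \<inter> U = {}"
    unfolding Q_def U_def connected_component_disjoint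
    using sep by (simp add: connected_component_sym_eq)
  have qU: "q \<in> X - closure U"
    using openin_Int_closure_empty[OF Q(1) QU] U Q(2) q by auto
  define V where "V = connected_component_set (X - closure U) q"
  have Vo: "openin (top_of_set X) V"
    unfolding V_def using clU
    by (intro openin_connected_component_set X) (simp add: closed_subset openin_diff)
  have V: "connected V" "q \<in> V" "V \<subseteq> X - closure U" "V \<in> components (X - closure U)"
    unfolding V_def using qU connected_component_subset[of "X - closure U"]
    by (auto simp: components_def)
  define K where "K = closure V \<inter> (X - V)"
  have clV: "closure V \<subseteq> X" using V X(1) by (meson Diff_subset closure_minimal order_trans)
  have UV: "U \<inter> V = {}" using V(3) closure_subset[of U] by auto
  \<comment> \<open>In a connected space, removing a component of the complement of a connected set
    leaves a connected set.\<close>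
  have "connected (X - V)"
    by (rule component_diff_connected[OF _ X(2) clU V(4)]) (simp add: U connected_imp_connected_closure)
  then have "connected K"
    unfolding K_def
    by (rule unicoherentD[OF X(4) connected_imp_connected_closure[OF V(1)]])
      (use clV closure_subset[of V] Vo in \<open>auto intro: closed_subset\<close>)
  \<comment> \<open>A boundary point of \<open>V\<close> lies in \<open>closure U\<close>, since
    \<open>V\<close> is closed in \<open>X - closure U\<close>. It is not in the relatively open set
    \<open>U\<close>, which is disjoint from \<open>V\<close>. As \<open>U\<close> is closed in
    \<open>X - L\<close>, only \<open>L\<close> remains.\<close>
  moreover have "K \<subseteq> L"
  proof
    fix x assume "x \<in> K"
    then have x: "x \<in> closure V" "x \<in> X" "x \<notin> V" by (auto simp: K_def)
    then have xU: "x \<in> closure U"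
      using closure_connected_component_Int[of "X - closure U" q] by (auto simp: V_def)
    have "x \<notin> U"
      using openin_Int_closure_empty[OF U(1) UV] V(3) x by auto
    then show "x \<in> L"
      using closure_connected_component_Int[of "X - L" p] x xU by (auto simp: U_def)
  qed
  moreover have "\<not> connected_component (X - K) p q"
  proof
    assume "connected_component (X - K) p q"
    then obtain T where T: "connected T" "T \<subseteq> X - K" "p \<in> T" "q \<in> T"
      by (auto simp: connected_component_def)
    obtain G where G: "open G" "V = X \<inter> G" using Vo by (auto simp: openin_open)
    have "p \<notin> closure V"
      using openin_Int_closure_empty[OF U(1) UV] V(3) U(3) by auto
    moreover have "V \<subseteq> closure V" by (rule closure_subset)
    \<comment> \<open>The relatively open \<open>V\<close> and the complement of
      \<open>closure V\<close> would disconnect \<open>T\<close>.\<close>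
    ultimately have "G \<inter> (- closure V) \<inter> T = {}" "T \<subseteq> G \<union> - closure V" "G \<inter> T \<noteq> {}" "- closure V \<inter> T \<noteq> {}"
      using T G V(2) by (auto simp: K_def)
    then show False
      using connectedD[OF T(1) G(1) open_Compl[OF closed_closure]] by auto
  qed
  ultimately show thesis using that by blast
qed

subsection \<open>Directions on the tree of level components\<close>

text \<open>Common setting for the sphere in dimension at least 3 and for the closed ball.\<close>

locale unicoherent_continuum_function =
  fixes X :: "'a::euclidean_space set" and f :: "'a \<Rightarrow> real"
  assumes compact: "compact X" and connected: "connected X"
    and locally_path_connected: "locally path_connected X"
    and unicoherent: "unicoherent X"
    and continuous: "continuous_on X f"
begin

text \<open>Vertices of the tree are represented by points of \<open>X\<close>, so one vertex has
  many names; for \<open>x\<close> outside \<open>X\<close> the set is empty.\<close>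

definition level_comp :: "'a \<Rightarrow> 'a set" where
  "level_comp x = connected_component_set {z \<in> X. f z = f x} x"

lemma locally_connected: "locally connected X"
  using locally_path_connected by (rule locally_path_connected_imp_locally_connected)

lemma closed: "closed X"
  using compact by (rule compact_imp_closed)

lemma compact_level: "compact {z \<in> X. f z = y}"
  using continuous_closedin_preimage_constant[OF continuous, of y] compact closedin_compact by blast

lemma level_comp_subset: "level_comp x \<subseteq> {z \<in> X. f z = f x}"
  unfolding level_comp_def by (rule connected_component_subset)

lemma mem_level_comp: "x \<in> X \<Longrightarrow> x \<in> level_comp x"
  by (simp add: level_comp_def)

lemma connected_level_comp: "connected (level_comp x)"
  by (simp add: level_comp_def)

lemma compact_level_comp: "compact (level_comp x)"
proof (cases "x \<in> X")
  case True
  then show ?thesis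
    unfolding level_comp_def
    by (intro compact_components[OF compact_level]) (auto simp: components_def)
next
  case False
  then have "level_comp x = {}"
    unfolding level_comp_def by (intro connected_component_eq_empty[THEN iffD2]) simp
  then show ?thesis
    by simp
qed

lemma closed_level_comp: "closed (level_comp x)"
  by (rule compact_imp_closed[OF compact_level_comp])

lemma level_comp_maximal:
  assumes "connected T" "T \<subseteq> X" "x \<in> T" "\<And>z. z \<in> T \<Longrightarrow> f z = f x"
  shows "T \<subseteq> level_comp x"
  unfolding level_comp_def using assms by (intro connected_component_maximal) blast+

lemma level_comp_eq:
  assumes "z \<in> level_comp x" shows "level_comp z = level_comp x"
proof -
  have "f z = f x" using assms level_comp_subset by blast
  then show ?thesis
    using assms connected_component_eq[of z "{w \<in> X. f w = f x}" x] by (simp add: level_comp_def)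
qed

lemma level_comp_disjoint_or_eq:
  "level_comp x \<inter> level_comp x' = {} \<or> level_comp x = level_comp x'"
  using level_comp_eq by blast

text \<open>Upper semicontinuity of the decomposition into level components. By Sura-Bura, the
  component has a neighbourhood inside \<open>N\<close> that is clopen in the compact level set.
  Thickening it gives an open \<open>G\<close> whose frontier misses the level, and compactness of
  the frontier in \<open>X\<close> yields \<open>\<delta>\<close>.\<close>

lemma level_comp_neighbourhood:
  assumes x: "x \<in> X" and N: "open N" "level_comp x \<subseteq> N"
  obtains G \<delta> where "open G" "level_comp x \<subseteq> G" "G \<subseteq> N" "\<delta> > 0"
    "\<And>z. z \<in> X \<Longrightarrow> z \<in> frontier G \<Longrightarrow> \<delta> \<le> \<bar>f z - f x\<bar>"
proof -
  define L where "L = {z \<in> X. f z = f x}"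
  have L: "compact L" unfolding L_def by (rule compact_level)
  have comp: "level_comp x \<in> components L"
    using x unfolding level_comp_def L_def components_def by auto
  obtain K where K: "openin (top_of_set L) K" "compact K" "level_comp x \<subseteq> K" "K \<subseteq> N"
    using Sura_Bura_clopen_subset[OF closed_imp_locally_compact[OF compact_imp_closed[OF L]] comp compact_level_comp N]
    by blast
  have KL: "K \<subseteq> L" using K(1) openin_imp_subset by blast
  have "closedin (top_of_set L) (L - K)" using K(1) by (simp add: closedin_diff)
  then have "closed (L - K)" using closedin_closed_trans compact_imp_closed[OF L] by blast
  \<comment> \<open>\<open>K\<close> and the rest of the level set are disjoint and closed;
    \<open>V\<close> keeps the rest away from \<open>closure G\<close>.\<close>
  then obtain U V where UV: "open U" "open V" "K \<subseteq> U" "L - K \<subseteq> V" "U \<inter> V = {}"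
    using separation_normal_compact[OF K(2), of "L - K"] by (metis Diff_disjoint)
  define G where "G = U \<inter> N"
  have G: "open G" "level_comp x \<subseteq> G" "G \<subseteq> N"
    using UV N K by (auto simp: G_def)
  define F where "F = X \<inter> frontier G"
  have F: "compact F" unfolding F_def by (intro compact_Int_closed compact) auto
  have ne: "f z \<noteq> f x" if "z \<in> F" for z
  proof
    assume "f z = f x"
    then have zL: "z \<in> L" using that by (auto simp: F_def L_def)
    have "z \<notin> G" using that G(1) by (auto simp: F_def frontier_def interior_open)
    then have "z \<in> V" using zL UV K(4) by (auto simp: G_def)
    moreover have "z \<in> closure G" using that by (auto simp: F_def frontier_def)
    moreover have "V \<inter> closure G = {}"
      using UV open_Int_closure_eq_empty[of V G] by (auto simp: G_def)
    ultimately show False by auto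
  qed
  show thesis
  proof (cases "F = {}")
    case True
    then show thesis using that[OF G, of 1] by (auto simp: F_def)
  next
    case False
    have "continuous_on F (\<lambda>z. \<bar>f z - f x\<bar>)"
      by (intro continuous_intros continuous_on_subset[OF continuous]) (auto simp: F_def)
    then obtain w where w: "w \<in> F" "\<And>z. z \<in> F \<Longrightarrow> \<bar>f w - f x\<bar> \<le> \<bar>f z - f x\<bar>"
      using continuous_attains_inf[OF F False] by metis
    show thesis
      by (rule that[OF G, of "\<bar>f w - f x\<bar>"]) (use w ne in \<open>auto simp: F_def\<close>)
  qed
qed

text \<open>A connected set leaving \<open>G\<close> would cross the frontier, where
  \<open>f\<close> is too far from \<open>y\<close>.\<close>

lemma level_comp_subset_neighbourhood:
  assumes "\<And>z. z \<in> X \<Longrightarrow> z \<in> frontier G \<Longrightarrow> \<delta> \<le> \<bar>f z - y\<bar>"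
    and "x' \<in> X" "x' \<in> G" "\<bar>f x' - y\<bar> < \<delta>"
  shows "level_comp x' \<subseteq> G"
proof (rule ccontr)
  assume "\<not> level_comp x' \<subseteq> G"
  then have "level_comp x' \<inter> frontier G \<noteq> {}"
    using connected_Int_frontier[OF connected_level_comp, of x' G] mem_level_comp assms by blast
  then show False
    using assms level_comp_subset[of x'] by fastforce
qed

text \<open>In the tree of level components, \<open>m x\<close> encodes a direction at the vertex \<open>level_comp x\<close>. Below, \<open>D x\<close>
  is the branch in this direction and \<open>K x\<close> the part of \<open>X\<close> left behind. At a maximal \<open>K x\<close>, a level component
  close to \<open>level_comp x\<close> that separates it from \<open>m x\<close> leaves even more behind.\<close>

lemma no_locally_constant_direction:
  assumes "X \<noteq> {}"
    and m: "\<And>x. x \<in> X \<Longrightarrow> \<exists>N. open N \<and> level_comp x \<subseteq> N \<and>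
      (\<forall>x'\<in>X. level_comp x' \<subseteq> N \<longrightarrow> connected_component (X - level_comp x') (m x) (m x'))"
  shows False
proof -
  define D where "D x = connected_component_set (X - level_comp x) (m x)" for x
  define K where "K x = X - D x" for x
  have mX: "m x \<in> X - level_comp x" if "x \<in> X" for x
    using m[OF that] that connected_component_in by blast
  have mD: "m x \<in> D x" if "x \<in> X" for x
    using mX[OF that] by (simp add: D_def)
  have Dsub: "D x \<subseteq> X - level_comp x" for x
    unfolding D_def by (rule connected_component_subset)
  have Dconn: "connected (D x)" for x
    by (simp add: D_def)
  have opX: "openin (top_of_set X) (X - level_comp x)" for x
    using level_comp_subset[of x] closed_level_comp[of x]
    by (intro openin_diff) (auto intro!: closed_subset)
  have Dopen: "openin (top_of_set X) (D x)" for x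
    unfolding D_def by (rule openin_connected_component_set[OF locally_connected opX])
  have Dmax: "T \<subseteq> D x" if "connected T" "T \<subseteq> X" "T \<inter> level_comp x = {}" "T \<inter> D x \<noteq> {}" for T x
  proof -
    from that obtain t where t: "t \<in> T" "t \<in> D x" by auto
    have "T \<subseteq> connected_component_set (X - level_comp x) t"
      using that t by (intro connected_component_maximal) auto
    then show ?thesis
      using t connected_component_eq[of t "X - level_comp x" "m x"] by (auto simp: D_def)
  qed
  have Dclos: "closure (D x) \<inter> X \<subseteq> D x \<union> level_comp x" for x
    using closure_connected_component_Int[of "X - level_comp x" "m x"] by (auto simp: D_def)
  \<comment> \<open>Again the complement of a component of the complement of a connected
    set.\<close>
  have Kconn: "connected (K x)" if "x \<in> X" for x
    unfolding K_def
    by (rule component_diff_connected[OF connected_level_comp[of x] connected])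
      (use level_comp_subset mX[OF that] in \<open>auto simp: D_def components_def\<close>)
  have CK: "level_comp x \<subseteq> K x" for x
    using Dsub level_comp_subset by (auto simp: K_def)
  \<comment> \<open>The boundary of a branch lies in its level component. With two disjoint such
    components the boundary would be empty and the branch clopen in the connected
    \<open>X\<close>.\<close>
  have D_eq: "level_comp x \<inter> level_comp x' \<noteq> {}" if "D x = D x'" "x \<in> X" for x x'
  proof
    assume "level_comp x \<inter> level_comp x' = {}"
    then have "closure (D x) \<inter> X \<subseteq> D x"
      using Dclos[of x] Dclos[of x'] that by auto
    then have "X \<inter> closure (D x) = D x"
      using Dsub[of x] closure_subset[of "D x"] by auto
    then have "closedin (top_of_set X) (D x)"
      by (metis closed_closure closedin_closed_Int)
    then have "D x = {} \<or> D x = X"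
      using connected Dopen[of x] by (auto simp: connected_clopen)
    then show False
      using mD[OF that(2)] Dsub[of x] mem_level_comp[OF that(2)] that(2) by auto
  qed
  \<comment> \<open>\<open>m\<close> may differ at two names of one vertex; local constancy, applied
    with \<open>level_comp x'\<close> equal to \<open>level_comp x\<close>, shows that the branch
    does not.\<close>
  have K_cong: "K x = K x'" if eq: "level_comp x = level_comp x'" and x: "x \<in> X" "x' \<in> X" for x x'
  proof -
    obtain N where N: "level_comp x \<subseteq> N"
      "\<And>x'. x'\<in>X \<Longrightarrow> level_comp x' \<subseteq> N \<Longrightarrow> connected_component (X - level_comp x') (m x) (m x')"
      using m[OF x(1)] by blast
    then have "connected_component (X - level_comp x') (m x) (m x')" using eq x by auto
    then have "D x = D x'" using eq by (metis D_def connected_component_eq mem_Collect_eq)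
    then show ?thesis by (simp add: K_def)
  qed
  \<comment> \<open>If \<open>level_comp x'\<close> missed \<open>D x\<close>, the connected
    \<open>D x\<close> would stay inside the smaller branch \<open>D x'\<close>.\<close>
  have strict: "level_comp x' \<subseteq> D x" if "K x \<subset> K x'" "x \<in> X" "x' \<in> X" for x x'
  proof -
    have dis: "level_comp x \<inter> level_comp x' = {}"
      using level_comp_disjoint_or_eq K_cong[of x x'] that by blast
    have D': "D x' \<subseteq> D x" "D x' \<noteq> D x"
      using that Dsub[of x'] by (auto simp: K_def)
    have "level_comp x' \<inter> D x \<noteq> {}"
    proof
      assume "level_comp x' \<inter> D x = {}"
      then have "D x \<subseteq> D x'"
        using Dmax[OF Dconn[of x], of x'] Dsub[of x] D' mD[OF that(3)] by blast
      then show False using D' by auto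
    qed
    then show ?thesis
      using Dmax[OF connected_level_comp, of x' x] dis level_comp_subset[of x'] by blast
  qed
  \<comment> \<open>The connected \<open>K x\<close> avoids \<open>level_comp x'\<close> and
    contains the point \<open>x\<close> outside \<open>D x'\<close>, so it misses
    \<open>D x'\<close> altogether.\<close>
  have strictI: "K x \<subset> K x'" if "level_comp x' \<subseteq> D x" "x \<in> X" "x' \<in> X" "x \<notin> D x'" for x x'
  proof -
    have "K x \<inter> level_comp x' = {}" using that by (auto simp: K_def)
    moreover have "x \<in> K x" using CK mem_level_comp that by blast
    ultimately have "K x \<inter> D x' = {}"
      using Dmax[OF Kconn[OF that(2)], of x'] that by (auto simp: K_def)
    moreover have "x' \<in> K x'" "x' \<notin> K x" using CK mem_level_comp that by (auto simp: K_def)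
    ultimately show ?thesis by (auto simp: K_def)
  qed
  \<comment> \<open>Zorn's lemma. For a chain without a largest element, the upper bound is
    \<open>K c\<close>, where \<open>c\<close> is a cluster point of the points \<open>z\<close>
    with \<open>K z\<close> in the chain; it exists by compactness of \<open>X\<close>.\<close>
  have "\<exists>M\<in>K ` X. \<forall>A\<in>K ` X. M \<subseteq> A \<longrightarrow> A = M"
  proof (rule subset_Zorn)
    fix \<C> assume chain: "subset.chain (K ` X) \<C>"
    show "\<exists>U\<in>K ` X. \<forall>A\<in>\<C>. A \<subseteq> U"
    proof (cases "\<exists>U\<in>\<C>. \<forall>A\<in>\<C>. A \<subseteq> U")
      case True
      then obtain U where U: "U \<in> \<C>" "\<forall>A\<in>\<C>. A \<subseteq> U" by blast
      moreover have "U \<in> K ` X" using U(1) chain by (auto simp: subset_chain_def)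
      ultimately show ?thesis by blast
    next
      case False
      have CC: "\<C> \<subseteq> K ` X" "\<And>A B. A \<in> \<C> \<Longrightarrow> B \<in> \<C> \<Longrightarrow> A \<subseteq> B \<or> B \<subseteq> A"
        using chain unfolding subset_chain_def by simp_all
      have nomax: "\<exists>B\<in>\<C>. A \<subset> B" if A: "A \<in> \<C>" for A
      proof -
        obtain B where B: "B \<in> \<C>" "\<not> B \<subseteq> A" using False A by blast
        then have "A \<subset> B" using CC(2)[OF A B(1)] by blast
        then show ?thesis using B(1) by blast
      qed
      define T where "T A = {z \<in> X. K z \<in> \<C> \<and> A \<subset> K z}" for A
      have "X \<inter> (\<Inter>A\<in>\<C>. closure (T A)) \<noteq> {}"
      proof (rule compact_imp_fip_image[OF compact])
        fix F assume F: "finite F" "F \<subseteq> \<C>"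
        have "\<exists>z\<in>X. \<forall>A\<in>F. z \<in> T A"
        proof (cases "F = {}")
          case True
          then show ?thesis using \<open>X \<noteq> {}\<close> by auto
        next
          case ne: False
          have "\<Union>F \<in> F"
            using F(1) ne
          proof (rule Union_in_chain)
            show "subset.chain UNIV F" using CC(2) F(2) by (auto simp: subset_chain_def)
          qed
          then obtain B where "B \<in> \<C>" "\<Union>F \<subset> B" using nomax F(2) by (meson subsetD)
          moreover from this obtain z where "z \<in> X" "B = K z" using CC(1) by blast
          ultimately have "z \<in> X" "\<forall>A\<in>F. z \<in> T A" unfolding T_def by blast+
          then show ?thesis by blast
        qed
        then obtain z where "z \<in> X" "\<forall>A\<in>F. z \<in> T A" by blast
        then have "z \<in> X \<inter> (\<Inter>A\<in>F. closure (T A))"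
          using closure_subset by blast
        then show "X \<inter> (\<Inter>A\<in>F. closure (T A)) \<noteq> {}"
          by blast
      qed auto
      then obtain c where c: "c \<in> X" "\<And>A. A \<in> \<C> \<Longrightarrow> c \<in> closure (T A)" by auto
      have TD: "T (K x) \<subseteq> D x" if "x \<in> X" for x
        using strict[OF _ that] mem_level_comp by (auto simp: T_def)
      \<comment> \<open>Choose \<open>K x'\<close> in the chain beyond \<open>K x\<close>. Then
        \<open>c\<close> lies in the closure of \<open>D x'\<close>, whereas \<open>K x\<close> lies
        in \<open>G\<close>, a relatively open set disjoint from \<open>D x'\<close>.\<close>
      have cK: "c \<notin> K x" if x: "x \<in> X" "K x \<in> \<C>" for x
      proof -
        obtain B where B: "B \<in> \<C>" "K x \<subset> B" using nomax x by blast
        then obtain x' where x': "x' \<in> X" "B = K x'" using CC by auto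
        define G where "G = X - level_comp x' - D x'"
        have "closedin (top_of_set (X - level_comp x')) (D x')"
          unfolding D_def by (rule closedin_connected_component)
        then have "openin (top_of_set X) G"
          unfolding G_def using opX openin_diff[of "top_of_set (X - level_comp x')" "X - level_comp x'" "D x'"]
            openin_trans by (metis openin_subtopology_self)
        moreover have "G \<inter> D x' = {}" by (auto simp: G_def)
        ultimately have "G \<inter> closure (D x') = {}"
          using openin_Int_closure_empty Dsub[of x'] by (metis Diff_subset order_trans)
        moreover have "c \<in> closure (D x')"
          using c(2)[OF B(1)] TD[OF x'(1)] closure_mono x' by blast
        moreover have "K x \<subseteq> G"
          using B strict[of x x'] x x' by (auto simp: G_def K_def)
        ultimately show ?thesis by auto
      qed
      obtain N where N: "open N" "level_comp c \<subseteq> N"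
        "\<And>x'. x'\<in>X \<Longrightarrow> level_comp x' \<subseteq> N \<Longrightarrow> connected_component (X - level_comp x') (m c) (m x')"
        using m[OF c(1)] by blast
      \<comment> \<open>Otherwise all of \<open>K x\<close> lies in \<open>D c\<close>. Then a point
        \<open>z\<close> of the chain near \<open>c\<close> has both \<open>m c\<close> and
        \<open>x\<close> in its branch, although \<open>K z\<close> contains
        \<open>K x\<close>.\<close>
      have "K x \<subseteq> K c" if x: "x \<in> X" "K x \<in> \<C>" for x
      proof (rule ccontr)
        assume "\<not> K x \<subseteq> K c"
        then have ne: "K x \<inter> D c \<noteq> {}" by (auto simp: K_def)
        have "level_comp c \<noteq> level_comp x"
          using cK[OF x] CK[of x] mem_level_comp[OF c(1)] by auto
        then have "level_comp c \<inter> level_comp x = {}"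
          using level_comp_disjoint_or_eq by blast
        then have "level_comp c \<subseteq> D x"
          using Dmax[OF connected_level_comp, of c x] cK[OF x] mem_level_comp[OF c(1)] level_comp_subset[of c] c(1)
          by (auto simp: K_def)
        then have "K x \<subseteq> D c"
          using Dmax[OF Kconn[OF x(1)] _ _ ne] by (auto simp: K_def)
        then have xD: "x \<in> D c" using CK mem_level_comp x by blast
        \<comment> \<open>The link from \<open>x\<close> to \<open>m c\<close> is taken to be a path
          because its image is compact, so \<open>N - P\<close> is still an open neighbourhood of
          \<open>level_comp c\<close>.\<close>
        have "path_component (D c) x (m c)"
          using path_component_eq_connected_component[OF locally_open_subset[OF locally_path_connected Dopen[of c]], of x]
            Dconn[of c] mD[OF c(1)] xD
          by (simp add: connected_iff_connected_component)
        then obtain g where g: "path g" "path_image g \<subseteq> D c" "pathstart g = x" "pathfinish g = m c"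
          by (auto simp: path_component_def)
        define P where "P = path_image g"
        have P: "compact P" "connected P" "x \<in> P" "m c \<in> P" "P \<subseteq> D c"
          using g pathstart_in_path_image[of g] pathfinish_in_path_image[of g] unfolding P_def by auto
        have "open (N - P)"
          using N(1) P(1) by (intro open_Diff compact_imp_closed)
        moreover have "level_comp c \<subseteq> N - P"
          using N(2) P(5) Dsub[of c] by blast
        ultimately have "open (N - P)" "level_comp c \<subseteq> N - P" .
        from level_comp_neighbourhood[OF c(1) this]
        obtain G \<delta> where G: "open G" "level_comp c \<subseteq> G" "G \<subseteq> N - P" "\<delta> > 0"
            "\<And>z. z \<in> X \<Longrightarrow> z \<in> frontier G \<Longrightarrow> \<delta> \<le> \<bar>f z - f c\<bar>"
          by blast
        have "openin (top_of_set X) (X \<inter> f -` {f c - \<delta><..<f c + \<delta>})"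
          by (rule continuous_openin_preimage_gen[OF continuous]) auto
        then have "openin (top_of_set X) (X \<inter> f -` {f c - \<delta><..<f c + \<delta>} \<inter> G)"
          by (simp add: G(1) openin_Int_open)
        then have "(X \<inter> f -` {f c - \<delta><..<f c + \<delta>} \<inter> G) \<inter> T (K x) \<noteq> {}"
        proof -
          have "c \<in> X \<inter> f -` {f c - \<delta><..<f c + \<delta>} \<inter> G"
            using c(1) G(2,4) mem_level_comp[OF c(1)] by auto
          moreover have "T (K x) \<subseteq> X" by (auto simp: T_def)
          ultimately show ?thesis
            using openin_Int_closure_empty[of X _ "T (K x)"] c(2)[OF x(2)]
              \<open>openin (top_of_set X) (X \<inter> f -` {f c - \<delta><..<f c + \<delta>} \<inter> G)\<close> by blast
        qed
        then obtain z where z0: "z \<in> X \<inter> f -` {f c - \<delta><..<f c + \<delta>} \<inter> G" "z \<in> T (K x)"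
          by blast
        then have z: "z \<in> X" "z \<in> G" "\<bar>f z - f c\<bar> < \<delta>" by auto
        have Kz: "K x \<subset> K z" using z0(2) unfolding T_def by blast
        have zG: "level_comp z \<subseteq> G"
          using level_comp_subset_neighbourhood[of G \<delta> "f c", OF G(5)] z by auto
        then have "m c \<in> D z"
          using N(3)[OF z(1)] G(3) unfolding D_def by (simp add: connected_component_sym_eq subset_iff)
        then have "P \<subseteq> D z"
        proof (intro Dmax P(2))
          show "P \<subseteq> X" using P(5) Dsub[of c] by blast
          show "P \<inter> level_comp z = {}" using zG G(3) by blast
          show "P \<inter> D z \<noteq> {}" using P(4) \<open>m c \<in> D z\<close> by blast
        qed
        then show False
          using P(3) Kz CK[of x] mem_level_comp[OF x(1)] unfolding K_def by blast
      qed
      then have "\<forall>A\<in>\<C>. A \<subseteq> K c" using CC(1) by (metis (no_types, lifting) image_iff subsetD)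
      then show ?thesis using c(1) by blast
    qed
  qed
  then obtain x where x: "x \<in> X" and max: "\<And>x'. x' \<in> X \<Longrightarrow> \<not> K x \<subset> K x'" by blast
  obtain N where N: "open N" "level_comp x \<subseteq> N"
    "\<And>x'. x'\<in>X \<Longrightarrow> level_comp x' \<subseteq> N \<Longrightarrow> connected_component (X - level_comp x') (m x) (m x')"
    using m[OF x] by blast
  \<comment> \<open>Deleting \<open>m x\<close> ensures that \<open>G\<close> does not contain it,
    so a shell inside \<open>G\<close> can separate it from \<open>x\<close>.\<close>
  have "open (N - {m x})" "level_comp x \<subseteq> N - {m x}"
    using N mX[OF x] by (auto intro: open_delete)
  from level_comp_neighbourhood[OF x this]
  obtain G \<delta> where G: "open G" "level_comp x \<subseteq> G" "G \<subseteq> N - {m x}" "\<delta> > 0"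
      "\<And>z. z \<in> X \<Longrightarrow> z \<in> frontier G \<Longrightarrow> \<delta> \<le> \<bar>f z - f x\<bar>"
    by blast
  have Gcl: "\<delta> \<le> \<bar>f z - f x\<bar>" if "z \<in> X" "z \<in> closure G" "z \<notin> G" for z
    using G(1,5) that by (auto simp: frontier_def interior_open)
  \<comment> \<open>The shell at half the gap \<open>\<delta>\<close>: it stays off the frontier of
    \<open>G\<close>, where the deviation is at least \<open>\<delta>\<close>, and off
    \<open>level_comp x\<close>, where it is zero.\<close>
  define L where "L = X \<inter> closure G \<inter> {z \<in> X. \<bar>f z - f x\<bar> = \<delta>/2}"
  have cont': "continuous_on X (\<lambda>z. \<bar>f z - f x\<bar>)"
    by (intro continuous_intros continuous)
  have "closedin (top_of_set X) {z \<in> X. \<bar>f z - f x\<bar> = \<delta>/2}"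
    by (rule continuous_closedin_preimage_constant[OF cont'])
  then have L: "closed L" "L \<subseteq> X"
    unfolding L_def using closed closedin_closed_trans by (blast intro: closed_Int)+
  have LG: "L \<subseteq> G" using Gcl G(4) by (force simp: L_def)
  have sep: "\<not> connected_component (X - L) x (m x)"
  proof
    assume "connected_component (X - L) x (m x)"
    then obtain T where T: "connected T" "T \<subseteq> X - L" "x \<in> T" "m x \<in> T"
      by (auto simp: connected_component_def)
    have cT: "continuous_on T (\<lambda>z. \<bar>f z - f x\<bar>)"
      using continuous_on_subset[OF cont'] T by blast
    \<comment> \<open>The inner part of \<open>T\<close>. As \<open>T\<close> avoids the shell,
      replacing \<open>G\<close> by its closure and the strict bound by the weak one changes
      nothing, so \<open>W\<close> is clopen in \<open>T\<close>; it contains \<open>x\<close> but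
      not \<open>m x\<close>.\<close>
    define W where "W = T \<inter> G \<inter> (T \<inter> (\<lambda>z. \<bar>f z - f x\<bar>) -` {..<\<delta>/2})"
    have "openin (top_of_set T) W"
      unfolding W_def by (intro openin_Int openin_open_Int G continuous_openin_preimage_gen[OF cT]) auto
    moreover have "W = T \<inter> closure G \<inter> (T \<inter> (\<lambda>z. \<bar>f z - f x\<bar>) -` {..\<delta>/2})"
    proof -
      have "z \<in> W" if "z \<in> T" "z \<in> closure G" "\<bar>f z - f x\<bar> \<le> \<delta>/2" for z
      proof -
        have "z \<in> G" using Gcl[of z] that T G(4) by force
        moreover have "\<bar>f z - f x\<bar> \<noteq> \<delta>/2" using that T by (auto simp: L_def)
        ultimately show ?thesis using that by (auto simp: W_def)
      qed
      then show ?thesis using closure_subset[of G] by (auto simp: W_def)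
    qed
    then have "closedin (top_of_set T) W"
      by (metis (no_types, lifting) cT closed_atMost closed_closure closedin_Int closedin_closed_Int continuous_closedin_preimage)
    ultimately have "W = {} \<or> W = T"
      using T(1) by (auto simp: connected_clopen)
    moreover have "x \<in> W" using T G mem_level_comp[OF x] by (auto simp: W_def)
    moreover have "m x \<notin> W" using G by (auto simp: W_def)
    ultimately show False using T by auto
  qed
  have xL: "x \<in> X - L" "m x \<in> X - L"
    using x mX[OF x] G(3,4) LG by (auto simp: L_def)
  obtain K0 where K0: "K0 \<subseteq> L" "connected K0" "\<not> connected_component (X - K0) x (m x)"
    using unicoherent_separation[OF closed connected locally_connected unicoherent L xL sep] by blast
  have "K0 \<noteq> {}"
    using K0(3) connected x mX[OF x] by (auto simp: connected_iff_connected_component)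
  then obtain x' where x': "x' \<in> K0" by auto
  then have x'X: "x' \<in> X" "x' \<in> G" "\<bar>f x' - f x\<bar> = \<delta>/2" using K0 LG by (auto simp: L_def)
  \<comment> \<open>On the shell \<open>f\<close> has only the two values
    \<open>f x + \<delta>/2\<close> and \<open>f x - \<delta>/2\<close>, and a connected set carries
    just one. Hence \<open>K0\<close> lies in a single level component, which therefore separates
    \<open>x\<close> from \<open>m x\<close>.\<close>
  have "f constant_on K0"
  proof (rule continuous_finite_range_constant[OF K0(2)])
    show "continuous_on K0 f" using continuous K0 L by (meson continuous_on_subset order_trans)
    have "f z = f x + \<delta>/2 \<or> f z = f x - \<delta>/2" if "z \<in> K0" for z
    proof -
      have "\<bar>f z - f x\<bar> = \<delta>/2" using that K0(1) by (auto simp: L_def)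
      then show ?thesis by linarith
    qed
    then have "f ` K0 \<subseteq> {f x + \<delta>/2, f x - \<delta>/2}" by auto
    then show "finite (f ` K0)" by (rule finite_subset) auto
  qed
  then have "f z = f x'" if "z \<in> K0" for z
    using that x' by (auto simp: constant_on_def)
  then have K0sub: "K0 \<subseteq> level_comp x'"
    using level_comp_maximal[OF K0(2) _ x'] K0(1) L(2) by blast
  have x'G: "level_comp x' \<subseteq> G"
    using level_comp_subset_neighbourhood[of G \<delta> "f x", OF G(5)] x'X G(4) by auto
  have mx: "m x \<in> D x'"
    using N(3)[OF x'X(1)] x'G G(3) unfolding D_def by (simp add: connected_component_sym_eq subset_iff)
  have xnD: "x \<notin> D x'"
  proof
    assume "x \<in> D x'"
    then have "connected_component (X - level_comp x') x (m x)"
      using mx unfolding D_def by (metis connected_component_eq mem_Collect_eq)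
    then show False
      using K0(3) K0sub by (meson Diff_mono connected_component_of_subset order_refl)
  qed
  have dis: "level_comp x \<inter> level_comp x' = {}"
    using level_comp_subset[of x] level_comp_subset[of x'] x'X(3) G(4) by fastforce
  \<comment> \<open>Otherwise the two branches coincide, against \<open>D_eq\<close>.\<close>
  have "level_comp x' \<inter> D x \<noteq> {}"
  proof
    assume A: "level_comp x' \<inter> D x = {}"
    have "D x \<subseteq> D x'"
      using Dmax[OF Dconn[of x], of x'] Dsub[of x] A mx mD[OF x] by blast
    moreover have "D x' \<inter> level_comp x = {}"
      using Dmax[OF connected_level_comp, of x x'] dis xnD mem_level_comp[OF x] level_comp_subset[of x] by blast
    then have "D x' \<subseteq> D x"
      using Dmax[OF Dconn[of x'], of x] Dsub[of x'] mx mD[OF x] by blast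
    ultimately show False using D_eq[of x x'] x dis by auto
  qed
  then have "level_comp x' \<subseteq> D x"
    using Dmax[OF connected_level_comp, of x' x] dis level_comp_subset[of x'] by blast
  then have "K x \<subset> K x'" using strictI x x'X(1) xnD by blast
  then show False using max x'X(1) by blast
qed

end

subsection \<open>Far apart points in a common level component\<close>

text \<open>If no level component contained an antipodal pair, \<open>uminus\<close> would be a
  locally constant direction. The dimension bound makes the sphere unicoherent.\<close>

lemma antipodal_points_in_level_set:
  fixes f :: "'a::euclidean_space \<Rightarrow> real"
  assumes dim: "3 \<le> DIM('a)" and f: "continuous_on (sphere 0 1) f"
  obtains T x where "connected T" "T \<subseteq> sphere 0 1" "f constant_on T" "x \<in> T" "- x \<in> T"
proof (rule ccontr)
  assume "\<not> thesis"
  with that have no: "connected T \<Longrightarrow> T \<subseteq> sphere 0 1 \<Longrightarrow> f constant_on T \<Longrightarrow> x \<in> T \<Longrightarrow> - x \<notin> T" for T x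
    by blast
  define X where "X = sphere (0::'a) 1"
  interpret unicoherent_continuum_function X f
  proof
    show "connected X" unfolding X_def using dim by (intro connected_sphere) auto
    show "unicoherent X" unfolding X_def by (intro Borsukian_imp_unicoherent Borsukian_sphere dim)
  qed (auto simp: X_def f locally_path_connected_sphere)
  have anti: "- z \<notin> level_comp x" if z: "z \<in> level_comp x" for x z
  proof
    assume "- z \<in> level_comp x"
    moreover have "f constant_on level_comp x"
      using level_comp_subset[of x] by (auto simp: constant_on_def)
    ultimately show False
      using no[OF connected_level_comp[of x] _ _ z] level_comp_subset[of x] unfolding X_def by blast
  qed
  show False
  proof (rule no_locally_constant_direction[where m = uminus])
    show "X \<noteq> {}" unfolding X_def by simp
    fix x assume x: "x \<in> X"
    have "compact (uminus ` level_comp x)"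
      by (intro compact_continuous_image compact_level_comp continuous_intros)
    then have "closed (uminus ` level_comp x)" by (rule compact_imp_closed)
    moreover have "level_comp x \<inter> uminus ` level_comp x = {}" using anti[of _ x] by auto
    ultimately obtain U V where UV: "open U" "open V" "level_comp x \<subseteq> U" "uminus ` level_comp x \<subseteq> V" "U \<inter> V = {}"
      using separation_normal_compact[OF compact_level_comp[of x], of "uminus ` level_comp x"] by metis
    \<comment> \<open>An open neighbourhood of \<open>level_comp x\<close> disjoint from its own
      antipodal image.\<close>
    define M where "M = U \<inter> uminus ` V"
    have M: "open M" "level_comp x \<subseteq> M" "M \<inter> uminus ` M = {}"
    proof -
      show "open M" unfolding M_def using UV(1,2) open_negations by (intro open_Int) auto
      have "z \<in> uminus ` V" if "z \<in> level_comp x" for z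
        using UV(4) that by (intro image_eqI[of _ _ "- z"]) auto
      then show "level_comp x \<subseteq> M" using UV(3) by (auto simp: M_def)
      show "M \<inter> uminus ` M = {}" using UV(5) by (auto simp: M_def)
    qed
    define W where "W = connected_component_set (X \<inter> M) x"
    have "openin (top_of_set X) W"
      unfolding W_def using M by (intro openin_connected_component_set locally_connected) auto
    then obtain N where N: "open N" "W = X \<inter> N" by (auto simp: openin_open)
    have W: "W \<subseteq> X \<inter> M" "connected W" "x \<in> W"
      unfolding W_def using connected_component_subset[of "X \<inter> M" x] x M(2) mem_level_comp[OF x] by auto
    have "level_comp x \<subseteq> W"
      unfolding W_def using M(2) mem_level_comp[OF x] level_comp_subset[of x]
      by (intro connected_component_maximal connected_level_comp) auto
    moreover have "connected_component (X - level_comp x') (- x) (- x')"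
      if x': "x' \<in> X" "level_comp x' \<subseteq> N" for x'
    proof -
      have sub: "level_comp x' \<subseteq> W" using x' N level_comp_subset[of x'] by auto
      have "connected (uminus ` W)"
        by (intro connected_continuous_image W continuous_intros)
      moreover have "uminus ` W \<subseteq> X - level_comp x'"
      proof -
        have "uminus ` W \<subseteq> uminus ` M" using W(1) by blast
        then have "uminus ` W \<inter> level_comp x' = {}" using M(3) W(1) sub by blast
        moreover have "uminus ` W \<subseteq> X" using W(1) by (auto simp: X_def)
        ultimately show ?thesis by blast
      qed
      moreover have "- x \<in> uminus ` W" "- x' \<in> uminus ` W"
        using W sub mem_level_comp[OF x'(1)] by auto
      ultimately show ?thesis by (auto simp: connected_component_def)
    qed
    ultimately show "\<exists>N. open N \<and> level_comp x \<subseteq> N \<and>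
      (\<forall>x'\<in>X. level_comp x' \<subseteq> N \<longrightarrow> connected_component (X - level_comp x') (- x) (- x'))"
      using N by auto
  qed
qed

section \<open>Spherical caps and the planar case\<close>

text \<open>The cap, centred at \<open>- a\<close>, is the radial projection of the cone
  \<open>Q\<close>, which is starlike about \<open>- a\<close>. In the plane it is an arc of length
  \<open>4 \<pi> / 3\<close>.\<close>

lemma connected_sphere_cap:
  fixes a :: "'a::euclidean_space"
  assumes a: "norm a = 1"
  shows "connected {z \<in> sphere 0 1. z \<bullet> a \<le> 1/2}"
proof -
  define Q where "Q = {z. z \<noteq> 0 \<and> z \<bullet> a \<le> norm z / 2}"
  have aQ: "- a \<in> Q" using a by (auto simp: Q_def dot_square_norm)
  have "closed_segment (- a) x \<subseteq> Q" if x: "x \<in> Q" for x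
  proof
    fix z assume "z \<in> closed_segment (- a) x"
    then obtain t where t: "0 \<le> t" "t \<le> 1" "z = t *\<^sub>R x - (1 - t) *\<^sub>R a"
      by (auto simp: closed_segment_def scaleR_minus_right algebra_simps)
    have xa: "x \<noteq> 0" "x \<bullet> a \<le> norm x / 2" using x by (auto simp: Q_def)
    have za: "z \<bullet> a = t * (x \<bullet> a) - (1 - t)"
      using t a by (simp add: inner_diff_left dot_square_norm)
    have "norm (t *\<^sub>R x) \<le> norm z + norm ((1 - t) *\<^sub>R a)"
      using norm_triangle_ineq[of z "(1 - t) *\<^sub>R a"] t by simp
    then have n: "t * norm x \<le> norm z + (1 - t)" using t a by simp
    have "t * (x \<bullet> a) \<le> t * (norm x / 2)" using xa t by (intro mult_left_mono) auto
    \<comment> \<open>The slack \<open>(1 - t) / 2\<close> also rules out \<open>z = 0\<close>: that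
      would force \<open>t = 1\<close>, hence \<open>z = x\<close>.\<close>
    then have "z \<bullet> a + (1 - t) / 2 \<le> norm z / 2" using n za by (simp add: field_simps)
    moreover have "z \<noteq> 0"
    proof
      assume "z = 0"
      with \<open>z \<bullet> a + (1 - t) / 2 \<le> norm z / 2\<close> have "t = 1" using t by simp
      then show False using \<open>z = 0\<close> t xa by simp
    qed
    moreover have "0 \<le> (1 - t) / 2" using t by simp
    ultimately have "z \<noteq> 0" "z \<bullet> a \<le> norm z / 2" by linarith+
    then show "z \<in> Q" by (simp add: Q_def)
  qed
  then have "starlike Q" using aQ by (auto simp: starlike_def)
  then have "connected Q" by (rule starlike_imp_connected)
  then have "connected (sgn ` Q)"
    by (intro connected_continuous_image continuous_intros) (auto simp: Q_def)
  moreover have "sgn ` Q = {z \<in> sphere 0 1. z \<bullet> a \<le> 1/2}"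
  proof (intro equalityI subsetI)
    fix z assume "z \<in> {z \<in> sphere 0 1. z \<bullet> a \<le> 1/2}"
    then have "z \<in> Q" "sgn z = z" by (auto simp: Q_def sgn_div_norm)
    then show "z \<in> sgn ` Q" by (metis imageI)
  qed (auto simp: Q_def norm_sgn sgn_div_norm field_simps)
  ultimately show ?thesis by simp
qed

text \<open>The direction of \<open>- (a + b)\<close> has nonpositive inner product with both
  \<open>a\<close> and \<open>b\<close>; if \<open>b = - a\<close>, any direction orthogonal to
  \<open>a\<close> serves.\<close>

lemma sphere_caps_intersect:
  fixes a b :: "'a::euclidean_space"
  assumes dim: "2 \<le> DIM('a)" and ab: "norm a = 1" "norm b = 1"
  shows "\<exists>z \<in> sphere 0 1. z \<bullet> a \<le> 1/2 \<and> z \<bullet> b \<le> 1/2"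
proof (cases "a + b = 0")
  case True
  obtain y where y: "y \<noteq> 0" "orthogonal a y"
    using orthogonal_to_vector_exists[OF dim, of a] by metis
  have "b = - a" using True by (simp add: add_eq_0_iff)
  then show ?thesis
    using y by (intro bexI[of _ "sgn y"]) (auto simp: norm_sgn orthogonal_def sgn_div_norm inner_commute)
next
  case False
  have "- 1 \<le> a \<bullet> b" using Cauchy_Schwarz_ineq2[of a b] ab by auto
  then have le: "(- (a + b)) \<bullet> a \<le> 0" "(- (a + b)) \<bullet> b \<le> 0"
    using ab by (simp_all add: inner_diff_left dot_square_norm inner_commute[of b a])
  have "sgn (- (a + b)) \<bullet> v = inverse (norm (- (a + b))) * ((- (a + b)) \<bullet> v)" for v
    unfolding sgn_div_norm by (rule inner_scaleR_left)
  then have "sgn (- (a + b)) \<bullet> a \<le> 0" "sgn (- (a + b)) \<bullet> b \<le> 0"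
    using le by (metis inverse_nonnegative_iff_nonnegative mult_nonneg_nonpos norm_ge_zero)+
  then show ?thesis
    using False by (intro bexI[of _ "sgn (- (a + b))"]) (auto simp: norm_sgn)
qed

text \<open>Otherwise each level component misses a cap \<open>J (a x)\<close>, and the cap centre
  \<open>- a x\<close> gives a direction. Compactness of \<open>T\<close> is recorded for the later
  choice of a farthest pair.\<close>

lemma level_set_meets_sphere_caps:
  fixes f :: "'a::euclidean_space \<Rightarrow> real"
  assumes dim: "2 \<le> DIM('a)" and f: "continuous_on (cball 0 1) f"
  shows "\<exists>T. connected T \<and> compact T \<and> T \<subseteq> cball 0 1 \<and> f constant_on T \<and>
    (\<forall>a. norm a = 1 \<longrightarrow> (\<exists>z \<in> T \<inter> sphere 0 1. z \<bullet> a \<le> 1/2))"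
proof (rule ccontr)
  assume "\<not> ?thesis"
  then have no: "connected T \<Longrightarrow> compact T \<Longrightarrow> T \<subseteq> cball 0 1 \<Longrightarrow> f constant_on T \<Longrightarrow>
      \<not> (\<forall>a. norm a = 1 \<longrightarrow> (\<exists>z \<in> T \<inter> sphere 0 1. z \<bullet> a \<le> 1/2))" for T
    by blast
  define X where "X = cball (0::'a) 1"
  define J where "J a = {z \<in> sphere (0::'a) 1. z \<bullet> a \<le> 1/2}" for a
  interpret unicoherent_continuum_function X f
    by unfold_locales
      (auto simp: X_def f convex_imp_locally_path_connected convex_imp_unicoherent)
  have "\<exists>a. norm a = 1 \<and> level_comp x \<inter> J a = {}" for x
  proof (rule ccontr)
    assume "\<not> (\<exists>a. norm a = 1 \<and> level_comp x \<inter> J a = {})"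
    then have "\<And>a. norm a = 1 \<Longrightarrow> \<exists>z \<in> level_comp x \<inter> sphere 0 1. z \<bullet> a \<le> 1/2"
      unfolding J_def by blast
    moreover have "f constant_on level_comp x"
      using level_comp_subset[of x] by (auto simp: constant_on_def)
    moreover have "level_comp x \<subseteq> cball 0 1"
      using level_comp_subset[of x] by (auto simp: X_def)
    ultimately show False
      using no[OF connected_level_comp[of x] compact_level_comp[of x]] by blast
  qed
  then obtain a where a: "\<And>x. norm (a x) = 1" "\<And>x. level_comp x \<inter> J (a x) = {}" by metis
  have J: "connected (J (a x))" "- a x \<in> J (a x)" "closed (J (a x))" "J (a x) \<subseteq> X" for x
  proof -
    show "connected (J (a x))" unfolding J_def by (rule connected_sphere_cap[OF a(1)])
    show "- a x \<in> J (a x)" using a(1)[of x] by (simp add: J_def dot_square_norm)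
    have "J (a x) = sphere 0 1 \<inter> {z. a x \<bullet> z \<le> 1/2}" by (auto simp: J_def inner_commute)
    then show "closed (J (a x))" by (metis closed_Int closed_halfspace_le closed_sphere)
    show "J (a x) \<subseteq> X" by (auto simp: J_def X_def)
  qed
  show False
  proof (rule no_locally_constant_direction[where m = "\<lambda>x. - a x"])
    show "X \<noteq> {}" unfolding X_def by simp
    fix x assume x: "x \<in> X"
    \<comment> \<open>Both caps avoid \<open>level_comp x'\<close>, and since they meet, their union
      is connected and joins the two centres.\<close>
    have "connected_component (X - level_comp x') (- a x) (- a x')"
      if x': "level_comp x' \<subseteq> - J (a x)" for x'
    proof -
      have "J (a x) \<inter> J (a x') \<noteq> {}"
        using sphere_caps_intersect[OF dim a(1)[of x] a(1)[of x']] by (auto simp: J_def)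
      then have "connected (J (a x) \<union> J (a x'))" using J by (intro connected_Un)
      moreover have "J (a x) \<union> J (a x') \<subseteq> X - level_comp x'"
        using J(4) a(2)[of x'] x' by blast
      ultimately show ?thesis
        using J(2) unfolding connected_component_def by blast
    qed
    then show "\<exists>N. open N \<and> level_comp x \<subseteq> N \<and>
      (\<forall>x'\<in>X. level_comp x' \<subseteq> N \<longrightarrow> connected_component (X - level_comp x') (- a x) (- a x'))"
      using J(3)[of x] a(2)[of x] by (intro exI[of _ "- J (a x)"] conjI ballI impI open_Compl) blast+
  qed
qed

text \<open>The hypothesis \<open>gram\<close> is the vanishing of the Gram determinant of three unit vectors in the plane
  with inner products \<open>s\<close>, \<open>b\<close>, \<open>c\<close>.\<close>

lemma gram_bound:
  fixes s b c :: real
  assumes gram: "1 + 2 * s * b * c = s\<^sup>2 + b\<^sup>2 + c\<^sup>2"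
    and s: "-1/2 < s" "s < 1" and bc: "s \<le> b" "s \<le> c"
  shows "1 + s \<le> b + c"
proof (rule ccontr)
  define S where "S = b + c"
  define E where "E = \<bar>b - c\<bar>"
  assume "\<not> ?thesis"
  then have less: "S < 1 + s" by (simp add: S_def)
  have E: "0 \<le> E" "E \<le> S - 2 * s" using bc by (auto simp: E_def S_def)
  have E2: "E\<^sup>2 = (b - c)\<^sup>2" by (simp add: E_def)
  \<comment> \<open>The Gram relation in terms of the sum \<open>S\<close> and the difference
    \<open>E\<close> of \<open>b\<close> and \<open>c\<close>.\<close>
  have id: "S\<^sup>2 * (1 - s) + E\<^sup>2 * (1 + s) = 2 * (1 - s) * (1 + s)"
    unfolding E2 S_def using gram by (simp add: power2_eq_square algebra_simps)
  have E2le: "E\<^sup>2 \<le> (S - 2 * s)\<^sup>2" using E by (intro power_mono) auto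
  have key: "2 * (1 - s) * (1 + s) \<le> S\<^sup>2 * (1 - s) + (S - 2 * s)\<^sup>2 * (1 + s)"
    using id mult_right_mono[OF E2le, of "1 + s"] s by linarith
  have S: "2 * s \<le> S" using E by linarith
  \<comment> \<open>The right-hand side of \<open>key\<close> minus its left-hand side factors. The
    factors have opposite signs: \<open>S < 1 + s\<close>, and \<open>S\<close> is at least
    \<open>2 * s\<close>, which exceeds \<open>2 * s\<^sup>2 + s - 1\<close>.\<close>
  have "S\<^sup>2 * (1 - s) + (S - 2 * s)\<^sup>2 * (1 + s) - 2 * (1 - s) * (1 + s)
      = 2 * (S - (1 + s)) * (S - (2 * s\<^sup>2 + s - 1))"
    by (simp add: power2_eq_square algebra_simps)
  moreover have "(S - (1 + s)) * (S - (2 * s\<^sup>2 + s - 1)) < 0"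
  proof (rule mult_neg_pos)
    have "(2 * s + 1) * (s - 1) < 0" using s by (intro mult_pos_neg) auto
    then show "0 < S - (2 * s\<^sup>2 + s - 1)" using S by (simp add: power2_eq_square algebra_simps)
  qed (use less in simp)
  ultimately show False using key by linarith
qed

text \<open>Three vectors in a plane are linearly dependent, so their Gram determinant vanishes; in
  coordinates this is a polynomial identity.\<close>

lemma gram_determinant_plane:
  fixes p q x :: "real ^ 'n"
  assumes n: "CARD('n) = 2"
  shows "(p \<bullet> p) * (q \<bullet> q) * (x \<bullet> x) + 2 * (p \<bullet> q) * (p \<bullet> x) * (q \<bullet> x)
    = (p \<bullet> q)\<^sup>2 * (x \<bullet> x) + (p \<bullet> x)\<^sup>2 * (q \<bullet> q) + (q \<bullet> x)\<^sup>2 * (p \<bullet> p)"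
proof -
  obtain i j :: 'n where ij: "UNIV = {i, j}" "i \<noteq> j"
    using n by (auto simp: card_2_iff)
  have inn: "u \<bullet> v = u $ i * v $ i + u $ j * v $ j" for u v :: "real ^ 'n"
    unfolding inner_vec_def ij(1) using ij(2) by simp
  show ?thesis
    unfolding inn by algebra
qed

text \<open>Take a farthest pair, that is, one of least inner product \<open>s\<close>. If
  \<open>s > -1/2\<close>, test the cap condition at the midpoint direction of \<open>p\<close> and
  \<open>q\<close>: the point \<open>x\<close> found there has \<open>x \<bullet> (p + q)\<close> at
  most \<open>norm (p + q) / 2\<close>, but at least \<open>1 + s\<close>, which is half the square
  of \<open>norm (p + q)\<close>. So \<open>norm (p + q) \<le> 1\<close>, forcing
  \<open>s \<le> -1/2\<close>.\<close>

lemma far_points_of_circle_subset: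
  fixes A :: "(real ^ 'n) set"
  assumes n: "CARD('n) = 2" and A: "compact A" "A \<subseteq> sphere 0 1"
    and caps: "\<And>a. norm a = 1 \<Longrightarrow> \<exists>z \<in> A. z \<bullet> a \<le> 1/2"
  obtains p q where "p \<in> A" "q \<in> A" "p \<bullet> q \<le> -1/2"
proof -
  have "A \<noteq> {}" using caps[of "axis undefined 1"] by auto
  then have "A \<times> A \<noteq> {}" by auto
  moreover have "continuous_on (A \<times> A) (\<lambda>z. fst z \<bullet> snd z)"
    by (intro continuous_intros)
  ultimately obtain pq where "pq \<in> A \<times> A" "\<And>z. z \<in> A \<times> A \<Longrightarrow> fst pq \<bullet> snd pq \<le> fst z \<bullet> snd z"
    using continuous_attains_inf[of "A \<times> A" "\<lambda>z. fst z \<bullet> snd z"] A(1) compact_Times by blast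
  then obtain p q where pq: "p \<in> A" "q \<in> A"
    and min: "\<And>x y. x \<in> A \<Longrightarrow> y \<in> A \<Longrightarrow> p \<bullet> q \<le> x \<bullet> y"
    by (metis SigmaE SigmaI fst_conv snd_conv)
  have unit: "norm x = 1" "x \<bullet> x = 1" if "x \<in> A" for x
    using A that by (auto simp: dot_square_norm)
  have "p \<bullet> q \<le> -1/2"
  proof (rule ccontr)
    assume s: "\<not> p \<bullet> q \<le> -1/2"
    define s where "s = p \<bullet> q"
    have s': "-1/2 < s" "s \<le> 1" using s norm_cauchy_schwarz[of p q] unit pq by (auto simp: s_def)
    have npq: "norm (p + q) ^ 2 = 2 + 2 * s"
      unfolding power2_norm_eq_inner using unit pq by (simp add: inner_add_left inner_add_right inner_commute s_def)
    have "p + q \<noteq> 0"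
    proof
      assume "p + q = 0"
      then have "2 + 2 * s = 0" using npq by simp
      then show False using s' by simp
    qed
    then have pos: "norm (p + q) > 0" by simp
    define a where "a = sgn (p + q)"
    have "norm a = 1" using pos by (simp add: a_def norm_sgn)
    then obtain x where x: "x \<in> A" "x \<bullet> a \<le> 1/2" using caps by blast
    have "1 + s \<le> x \<bullet> p + x \<bullet> q"
    \<comment> \<open>\<open>gram_bound\<close> requires \<open>s < 1\<close>; for
      \<open>s = 1\<close> minimality alone gives the bound.\<close>
    proof (cases "s = 1")
      case True
      then have "1 \<le> x \<bullet> p" "1 \<le> x \<bullet> q" using min[OF x(1) pq(1)] min[OF x(1) pq(2)] by (auto simp: s_def)
      then show ?thesis using True by simp
    next
      case False
      show ?thesis
      proof (rule gram_bound)
        show "1 + 2 * s * (x \<bullet> p) * (x \<bullet> q) = s\<^sup>2 + (x \<bullet> p)\<^sup>2 + (x \<bullet> q)\<^sup>2"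
          using gram_determinant_plane[OF n, of p q x] unit pq x by (simp add: s_def inner_commute)
      qed (use s' False min x pq in \<open>auto simp: s_def\<close>)
    qed
    moreover have "x \<bullet> a = x \<bullet> (p + q) / norm (p + q)"
      unfolding a_def sgn_div_norm inner_scaleR_right by (simp add: divide_inverse_commute)
    then have "x \<bullet> (p + q) \<le> norm (p + q) / 2"
      using x(2) pos by (simp add: pos_divide_le_eq)
    ultimately have "norm (p + q) ^ 2 \<le> norm (p + q)"
      using npq by (simp add: inner_add_right)
    then have "norm (p + q) \<le> 1" using pos by (simp add: power2_eq_square)
    then have "norm (p + q) ^ 2 \<le> 1" using pos by (simp add: power_le_one)
    then show False using npq s' by simp
  qed
  then show thesis using that pq by blast
qed

text \<open>The plane uses the whole disc, where inner product at most \<open>-1/2\<close> means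
  distance at least \<open>sqrt 3\<close>; higher dimensions use only the restriction of
  \<open>f\<close> to the sphere.\<close>

lemma far_points_in_level_set:
  fixes f :: "real ^ 'n \<Rightarrow> real"
  assumes n: "CARD('n) \<ge> 2" and f: "continuous_on (cball 0 1) f"
  shows "\<exists>T x y. connected T \<and> T \<subseteq> cball 0 1 \<and> f constant_on T \<and>
    x \<in> T \<and> y \<in> T \<and> norm x = 1 \<and> norm y = 1 \<and>
    (CARD('n) = 2 \<longrightarrow> norm (x - y) \<ge> sqrt 3) \<and> (CARD('n) \<ge> 3 \<longrightarrow> norm (x - y) = 2)"
proof (cases "CARD('n) = 2")
  case True
  obtain T where T: "connected T" "compact T" "T \<subseteq> cball 0 1" "f constant_on T"
    and caps: "\<And>a. norm a = 1 \<Longrightarrow> \<exists>z \<in> T \<inter> sphere 0 1. z \<bullet> a \<le> 1/2"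
    using level_set_meets_sphere_caps[OF _ f] n by auto
  have "compact (T \<inter> sphere 0 1)" using T(2) by (intro compact_Int_closed) auto
  then obtain p q where pq: "p \<in> T \<inter> sphere 0 1" "q \<in> T \<inter> sphere 0 1" "p \<bullet> q \<le> -1/2"
    using far_points_of_circle_subset[OF True _ _ caps] by blast
  have "p \<bullet> p = 1" "q \<bullet> q = 1" using pq by (simp_all add: dot_square_norm)
  then have "(norm (p - q))\<^sup>2 = 2 - 2 * (p \<bullet> q)"
    using \<open>p \<bullet> p = 1\<close> \<open>q \<bullet> q = 1\<close>
    by (simp add: power2_norm_eq_inner inner_diff_left inner_diff_right inner_commute[of q p])
  then have "3 \<le> (norm (p - q))\<^sup>2" using pq(3) by simp
  then have "sqrt 3 \<le> norm (p - q)" by (rule real_le_lsqrt[OF norm_ge_zero])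
  then show ?thesis using T pq True
    by (intro exI[of _ T] exI[of _ p] exI[of _ q]) auto
next
  case False
  have "continuous_on (sphere 0 1) f" using f by (rule continuous_on_subset) auto
  then obtain T x where T: "connected T" "T \<subseteq> sphere 0 1" "f constant_on T" "x \<in> T" "- x \<in> T"
    using antipodal_points_in_level_set[of f] n False by auto
  then have "norm x = 1" by auto
  moreover have "x - (- x) = 2 *\<^sub>R x" by (simp add: scaleR_2)
  then have "norm (x - (- x)) = 2" using \<open>norm x = 1\<close> by (simp del: diff_minus_eq_add)
  moreover have "T \<subseteq> cball 0 1" using T(2) by auto
  ultimately show ?thesis using T False
    by (intro exI[of _ T] exI[of _ x] exI[of _ "- x"]) simp
qed

section \<open>Limits at the boundary and the Reeb width\<close>

lemma connected_constant_in_contour: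
  assumes "connected T" "T \<subseteq> X" "f constant_on T" "T \<noteq> {}"
  obtains C where "C \<in> contours X f" "T \<subseteq> C"
proof -
  obtain t where t: "t \<in> T" using assms by auto
  define L where "L = {x \<in> X. f x = f t}"
  have "T \<subseteq> L" using assms t by (auto simp: L_def constant_on_def)
  then have "T \<subseteq> connected_component_set L t" "connected_component_set L t \<in> components L"
    using assms(1) t by (auto simp: connected_component_maximal components_def)
  then show thesis using that by (auto simp: contours_def L_def)
qed

text \<open>Continuity is available only on \<open>E\<close>, which may be open, so \<open>f\<close>
  is studied on concentric balls of radius \<open>r k\<close> tending to 1, rescaled to the unit
  ball. The far pairs found there subconverge on the sphere; the limit points are approached by
  contours but need not lie on one.\<close>

lemma almost_joined_boundary_points:
  fixes c :: "real ^ 'n" and E :: "(real ^ 'n) set"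
  assumes n: "CARD('n) \<ge> 2" and E: "ball c 1 \<subseteq> E" and f: "continuous_on E f"
  shows "\<exists>x \<in> sphere c 1. \<exists>y \<in> sphere c 1.
    (CARD('n) = 2 \<longrightarrow> norm (x - y) \<ge> sqrt 3) \<and> (CARD('n) \<ge> 3 \<longrightarrow> norm (x - y) = 2) \<and>
    (\<forall>U V. x \<in> interior U \<and> y \<in> interior V \<longrightarrow>
      (\<exists>C \<in> contours E f. C \<inter> U \<noteq> {} \<and> C \<inter> V \<noteq> {}))"
proof -
  \<comment> \<open>The value \<open>r 0 = 0\<close> collapses the ball to its centre, which does no
    harm as only the limit matters.\<close>
  define r :: "nat \<Rightarrow> real" where "r k = 1 + - inverse (real (Suc k))" for k
  have r: "0 \<le> r k" "r k < 1" for k by (auto simp: r_def field_simps)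
  define h where "h k z = c + r k *\<^sub>R z" for k and z :: "real ^ 'n"
  have h: "h k ` cball 0 1 \<subseteq> E" for k
  proof -
    have "norm (r k *\<^sub>R z) < 1" if "norm z \<le> 1" for z :: "real ^ 'n"
    proof -
      have "r k * norm z \<le> r k * 1" using that r by (intro mult_left_mono) auto
      then show ?thesis using r[of k] by simp
    qed
    then have "h k ` cball 0 1 \<subseteq> ball c 1" by (auto simp: h_def dist_norm)
    then show ?thesis using E by auto
  qed
  have hcont: "continuous_on S (h k)" for S k
    unfolding h_def by (intro continuous_intros)
  have "continuous_on (cball 0 1) (f \<circ> h k)" for k
    by (rule continuous_on_compose[OF hcont continuous_on_subset[OF f h]])
  then have "\<forall>k. \<exists>T x y. connected T \<and> T \<subseteq> cball 0 1 \<and> (f \<circ> h k) constant_on T \<and>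
    x \<in> T \<and> y \<in> T \<and> norm x = 1 \<and> norm y = 1 \<and>
    (CARD('n) = 2 \<longrightarrow> norm (x - y) \<ge> sqrt 3) \<and> (CARD('n) \<ge> 3 \<longrightarrow> norm (x - y) = 2)"
    using far_points_in_level_set[OF n] by blast
  then obtain T x y where T: "\<And>k. connected (T k)" "\<And>k. T k \<subseteq> cball 0 1" "\<And>k. (f \<circ> h k) constant_on T k"
    and xy: "\<And>k. x k \<in> T k" "\<And>k. y k \<in> T k" "\<And>k. norm (x k) = 1" "\<And>k. norm (y k) = 1"
    and far: "\<And>k. CARD('n) = 2 \<Longrightarrow> norm (x k - y k) \<ge> sqrt 3"
      "\<And>k. CARD('n) \<ge> 3 \<Longrightarrow> norm (x k - y k) = 2"
    by metis
  \<comment> \<open>Working in the product gives one subsequence along which both points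
    converge.\<close>
  have "seq_compact (sphere (0::real ^ 'n) 1 \<times> sphere (0::real ^ 'n) 1)"
    by (intro compact_imp_seq_compact compact_Times compact_sphere)
  moreover have "\<forall>k. (x k, y k) \<in> sphere 0 1 \<times> sphere 0 1" using xy by auto
  ultimately obtain l \<sigma> where l: "l \<in> sphere 0 1 \<times> sphere 0 1" and \<sigma>: "strict_mono (\<sigma> :: nat \<Rightarrow> nat)"
    and lim: "((\<lambda>k. (x k, y k)) \<circ> \<sigma>) \<longlonglongrightarrow> l"
    by (rule seq_compactE)
  obtain x0 y0 where l_eq: "l = (x0, y0)" by (cases l)
  have x0: "norm x0 = 1" "norm y0 = 1" using l by (auto simp: l_eq)
  have limx: "(\<lambda>k. x (\<sigma> k)) \<longlonglongrightarrow> x0" and limy: "(\<lambda>k. y (\<sigma> k)) \<longlonglongrightarrow> y0"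
    using tendsto_fst[OF lim] tendsto_snd[OF lim] by (simp_all add: l_eq o_def)
  have limn: "(\<lambda>k. norm (x (\<sigma> k) - y (\<sigma> k))) \<longlonglongrightarrow> norm (x0 - y0)"
    by (intro tendsto_intros limx limy)
  have "r \<longlonglongrightarrow> 1"
    unfolding r_def by (rule LIMSEQ_inverse_real_of_nat_add_minus)
  then have limr: "(\<lambda>k. r (\<sigma> k)) \<longlonglongrightarrow> 1"
    using LIMSEQ_subseq_LIMSEQ[OF _ \<sigma>] by (force simp: o_def)
  have limh: "(\<lambda>k. h (\<sigma> k) (x (\<sigma> k))) \<longlonglongrightarrow> c + x0" "(\<lambda>k. h (\<sigma> k) (y (\<sigma> k))) \<longlonglongrightarrow> c + y0"
    unfolding h_def using tendsto_scaleR[OF limr limx] tendsto_scaleR[OF limr limy]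
    by (auto intro!: tendsto_intros)
  have "norm (x0 - y0) \<ge> sqrt 3" if "CARD('n) = 2"
    using limn far(1)[OF that] by (intro LIMSEQ_le_const[OF limn]) auto
  moreover have "norm (x0 - y0) = 2" if "CARD('n) \<ge> 3"
    using limn far(2)[OF that] by (simp add: LIMSEQ_const_iff)
  moreover have "\<exists>C \<in> contours E f. C \<inter> U \<noteq> {} \<and> C \<inter> V \<noteq> {}"
    if UV: "c + x0 \<in> interior U" "c + y0 \<in> interior V" for U V
  proof -
    have "eventually (\<lambda>k. h (\<sigma> k) (x (\<sigma> k)) \<in> interior U \<and> h (\<sigma> k) (y (\<sigma> k)) \<in> interior V) sequentially"
      using limh UV by (intro eventually_conj topological_tendstoD) auto
    then obtain j where j: "h j (x j) \<in> interior U" "h j (y j) \<in> interior V"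
      by (auto simp: eventually_sequentially)
    have "connected (h j ` T j)"
      by (intro connected_continuous_image hcont T)
    moreover have "h j ` T j \<subseteq> E" using h T(2) by blast
    moreover have "f constant_on h j ` T j" using T(3)[of j] by (auto simp: constant_on_def)
    moreover have "h j ` T j \<noteq> {}" using xy(1)[of j] by auto
    ultimately obtain C where "C \<in> contours E f" "h j ` T j \<subseteq> C"
      by (rule connected_constant_in_contour)
    then show ?thesis using j xy(1,2) interior_subset by (intro bexI[of _ C]) blast+
  qed
  ultimately show ?thesis
    using x0 by (intro bexI[of _ "c + x0"] bexI[of _ "c + y0"]) (auto simp: dist_norm)
qed

text \<open>A contour meeting the balls of radius \<open>e/2\<close> about \<open>x\<close> and
  \<open>y\<close> contains two points at distance at least \<open>dist x y - e\<close>.\<close>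

lemma ediameter_contour_SUP_ge:
  assumes "\<And>U V. x \<in> interior U \<and> y \<in> interior V \<Longrightarrow> \<exists>C \<in> contours E f. C \<inter> U \<noteq> {} \<and> C \<inter> V \<noteq> {}"
  shows "ennreal (dist x y) \<le> (SUP C \<in> contours E f. ediameter C)"
proof (rule ennreal_le_epsilon)
  fix e :: real assume e: "0 < e"
  obtain C where C: "C \<in> contours E f" "C \<inter> ball x (e/2) \<noteq> {}" "C \<inter> ball y (e/2) \<noteq> {}"
    using assms[of "ball x (e/2)" "ball y (e/2)"] e by auto
  then obtain u v where uv: "u \<in> C" "v \<in> C" "dist x u < e/2" "dist y v < e/2" by auto
  have "dist x y \<le> dist u v + e"
    using uv dist_triangle[of x y u] dist_triangle[of u y v] by (simp add: dist_commute)
  then have "ennreal (dist x y) \<le> ennreal (dist u v) + ennreal e"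
    using e by (metis ennreal_leI ennreal_plus less_imp_le zero_le_dist)
  also have "ennreal (dist u v) \<le> ediameter C"
    unfolding ediameter_def using uv by (intro SUP_upper2[of u] SUP_upper2[of v]) auto
  also have "ediameter C \<le> (SUP C \<in> contours E f. ediameter C)"
    using C(1) by (rule SUP_upper)
  finally show "ennreal (dist x y) \<le> (SUP C \<in> contours E f. ediameter C) + ennreal e"
    by (simp add: add_mono)
qed

text \<open>The constant function is a competitor, and its contours lie in \<open>E\<close>.\<close>

lemma reeb_width_le:
  assumes "\<And>u v. u \<in> E \<Longrightarrow> v \<in> E \<Longrightarrow> dist u v \<le> d"
  shows "reeb_width E \<le> ennreal d"
proof -
  have "ediameter C \<le> ennreal d" if "C \<in> contours E (\<lambda>_. 0)" for C
  proof -
    have "C \<subseteq> E" using that in_components_subset by (fastforce simp: contours_def)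
    then show ?thesis
      unfolding ediameter_def using assms by (intro SUP_least ennreal_leI) blast
  qed
  then show ?thesis
    unfolding reeb_width_def by (intro INF_lower2[of "\<lambda>_. 0"] SUP_least) auto
qed

theorem proposition6p3:
  fixes c :: "real ^ 'n" and E :: "(real ^ 'n) set"
  assumes "CARD('n) \<ge> 2"
    and "E = ball c 1 \<or> E = cball c 1"
  shows "(CARD('n) = 2 \<longrightarrow> reeb_width E \<ge> ennreal (sqrt 3)) \<and>
    (CARD('n) \<ge> 3 \<longrightarrow> reeb_width E = 2) \<and>
    (\<forall>f :: real ^ 'n \<Rightarrow> real. continuous_on E f \<longrightarrow>
      (\<exists>x \<in> sphere c 1. \<exists>y \<in> sphere c 1.
        (CARD('n) = 2 \<longrightarrow> norm (x - y) \<ge> sqrt 3) \<and>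
        (CARD('n) \<ge> 3 \<longrightarrow> norm (x - y) = 2) \<and>
        (\<forall>U V. x \<in> interior U \<and> y \<in> interior V \<longrightarrow>
          (\<exists>C \<in> contours E f. C \<inter> U \<noteq> {} \<and> C \<inter> V \<noteq> {}))))"
proof -
  have "ball c 1 \<subseteq> E" using assms(2) by auto
  note joined = almost_joined_boundary_points[OF assms(1) this]
  \<comment> \<open>The parameter \<open>d\<close> treats both dimension ranges at once.\<close>
  have lower: "ennreal d \<le> reeb_width E"
    if d: "CARD('n) = 2 \<and> d = sqrt 3 \<or> CARD('n) \<ge> 3 \<and> d = 2" for d
    unfolding reeb_width_def
  proof (rule INF_greatest)
    fix f :: "real ^ 'n \<Rightarrow> real" assume "f \<in> {f. continuous_on E f}"
    then obtain x y where xy: "CARD('n) = 2 \<longrightarrow> norm (x - y) \<ge> sqrt 3" "CARD('n) \<ge> 3 \<longrightarrow> norm (x - y) = 2"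
      "\<forall>U V. x \<in> interior U \<and> y \<in> interior V \<longrightarrow> (\<exists>C \<in> contours E f. C \<inter> U \<noteq> {} \<and> C \<inter> V \<noteq> {})"
      using joined[of f] by blast
    have "d \<le> dist x y" using xy(1,2) d by (auto simp: dist_norm)
    then have "ennreal d \<le> ennreal (dist x y)" by (rule ennreal_leI)
    also have "\<dots> \<le> (SUP C \<in> contours E f. ediameter C)"
      using xy(3) by (intro ediameter_contour_SUP_ge) blast
    finally show "ennreal d \<le> (SUP C \<in> contours E f. ediameter C)" .
  qed
  \<comment> \<open>The matching upper bound 2 is the diameter of the unit ball.\<close>
  have "dist u v \<le> 2" if "u \<in> E" "v \<in> E" for u v
  proof -
    have "dist c u \<le> 1" "dist c v \<le> 1" using that assms(2) by auto
    then show ?thesis using dist_triangle2[of u v c] by (simp add: dist_commute)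
  qed
  then have "reeb_width E \<le> ennreal 2" by (rule reeb_width_le)
  moreover have "ennreal 2 = 2" by simp
  ultimately have "reeb_width E = 2" if "CARD('n) \<ge> 3"
    using lower[of 2] that by (metis antisym)
  then show ?thesis
    using lower[of "sqrt 3"] joined by blast
qed

end
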